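(* Let $V$ be a near vector space over a commutative $F$ with $n$ blocks ($n$ finite). Then the complete theory $T=\mathrm{Th}(V)$ in the language $\mathcal L_{Fnvs}=\{+,0,(\lambda)_{\lambda\in F}\}$ is totally transcendental.
   Context: A near vector space $(V,F)$: $(V,+)$ a group, $F$ a set of endomorphisms containing $0,1,-1$, with $F\setminus\{0\}$ a subgroup of $\mathrm{Aut}(V,+)$ acting fixed point freely ($\alpha x=\beta x\Rightarrow\alpha=\beta$ or $x=0$), such that the quasi-kernel $Q(V)=\{u:\forall\alpha,\beta\in F\,\exists\gamma\in F\ \alpha u+\beta u=\gamma u\}$ generates $V$. Commutative: $\alpha(\beta v)=\beta(\alpha v)$. The blocks of $V$ are the summands in André's decomposition of $V$ into maximal regular near vector subspaces (regular: any two nonzero quasi-kernel elements $u,v$ satisfy $u+\lambda v\in Q(V)$ for some $\lambda\neq0$), each nonzero element of $Q(V)$ lying in exactly one block. In $\mathcal L_{Fnvs}$ each $\lambda\in F$ is a unary function symbol interpreted as its action. A theory $T$ is totally transcendental if it is $\lambda$-stable for every infinite $\lambda\geq|\mathcal L|$, where $\lambda$-stable means that for every model $M$ and $A\subseteq M$ with $|A|\leq\lambda$ there are at most $\lambda$ complete 1-types over $A$ (equivalently, every formula has ordinal-valued Morley rank). *)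

theory Defs
  imports Main "HOL-Library.Equipollence"
begin

section \<open>Near vector spaces\<close>

text \<open>The additive group of V is the type 'v (class group_add, not assumed abelian);
  F is a set of maps 'v => 'v (the scalars acting on V).\<close>

definition zero_map :: "'v::group_add \<Rightarrow> 'v" where
  "zero_map = (\<lambda>x. 0)"

definition quasi_kernel :: "('v::group_add \<Rightarrow> 'v) set \<Rightarrow> 'v set" where
  "quasi_kernel F = {u. \<forall>\<alpha>\<in>F. \<forall>\<beta>\<in>F. \<exists>\<gamma>\<in>F. \<alpha> u + \<beta> u = \<gamma> u}"

inductive_set gen_subgroup :: "'v::group_add set \<Rightarrow> 'v set" for S where
  gen_zero: "0 \<in> gen_subgroup S"
| gen_base: "x \<in> S \<Longrightarrow> x \<in> gen_subgroup S"
| gen_plus: "x \<in> gen_subgroup S \<Longrightarrow> y \<in> gen_subgroup S \<Longrightarrow> x + y \<in> gen_subgroup S"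
| gen_uminus: "x \<in> gen_subgroup S \<Longrightarrow> - x \<in> gen_subgroup S"

definition near_vector_space :: "('v::group_add \<Rightarrow> 'v) set \<Rightarrow> bool" where
  "near_vector_space F \<longleftrightarrow>
     (\<forall>\<alpha>\<in>F. \<forall>x y. \<alpha> (x + y) = \<alpha> x + \<alpha> y)
   \<and> zero_map \<in> F \<and> id \<in> F \<and> uminus \<in> F
   \<and> (\<forall>\<alpha>\<in>F - {zero_map}. bij \<alpha> \<and> inv \<alpha> \<in> F)
   \<and> (\<forall>\<alpha>\<in>F - {zero_map}. \<forall>\<beta>\<in>F - {zero_map}. \<alpha> \<circ> \<beta> \<in> F)
   \<and> (\<forall>\<alpha>\<in>F. \<forall>\<beta>\<in>F. \<forall>x. \<alpha> x = \<beta> x \<longrightarrow> \<alpha> = \<beta> \<or> x = 0)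
   \<and> gen_subgroup (quasi_kernel F) = UNIV"

definition commutative_nvs :: "('v::group_add \<Rightarrow> 'v) set \<Rightarrow> bool" where
  "commutative_nvs F \<longleftrightarrow> (\<forall>\<alpha>\<in>F. \<forall>\<beta>\<in>F. \<forall>v. \<alpha> (\<beta> v) = \<beta> (\<alpha> v))"

text \<open>Blocks: two nonzero quasi-kernel elements u, v lie in the same block iff
  u + \<lambda> v \<in> Q(V) for some nonzero \<lambda> (taking the equivalence closure of this relation);
  each block contains exactly one class of nonzero quasi-kernel elements, so the
  blocks are in bijection with the classes below.\<close>

definition block_rel :: "('v::group_add \<Rightarrow> 'v) set \<Rightarrow> ('v \<times> 'v) set" where
  "block_rel F = {(u, v). u \<in> quasi_kernel F - {0} \<and> v \<in> quasi_kernel F - {0}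
       \<and> (\<exists>c\<in>F - {zero_map}. u + c v \<in> quasi_kernel F)}"

definition blocks :: "('v::group_add \<Rightarrow> 'v) set \<Rightarrow> 'v set set" where
  "blocks F = (quasi_kernel F - {0}) // ((block_rel F \<union> (block_rel F)\<inverse>)\<^sup>*)"

section \<open>First-order language L_Fnvs = {+, 0, (\<lambda>)_{\<lambda>\<in>F}} with parameters\<close>

datatype ('s, 'p) trm = Var nat | Zero | Plus "('s, 'p) trm" "('s, 'p) trm"
  | Fun 's "('s, 'p) trm" | Par 'p

datatype ('s, 'p) fm = Eq "('s, 'p) trm" "('s, 'p) trm" | Neg "('s, 'p) fm"
  | Conj "('s, 'p) fm" "('s, 'p) fm" | Ex nat "('s, 'p) fm"

record ('s, 'b) struc =
  s_plus :: "'b \<Rightarrow> 'b \<Rightarrow> 'b"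
  s_zero :: "'b"
  s_fun :: "'s \<Rightarrow> 'b \<Rightarrow> 'b"

fun tsyms :: "('s, 'p) trm \<Rightarrow> 's set" where
  "tsyms (Var n) = {}" | "tsyms Zero = {}" | "tsyms (Plus s t) = tsyms s \<union> tsyms t"
| "tsyms (Fun f t) = insert f (tsyms t)" | "tsyms (Par a) = {}"

fun tpars :: "('s, 'p) trm \<Rightarrow> 'p set" where
  "tpars (Var n) = {}" | "tpars Zero = {}" | "tpars (Plus s t) = tpars s \<union> tpars t"
| "tpars (Fun f t) = tpars t" | "tpars (Par a) = {a}"

fun tvars :: "('s, 'p) trm \<Rightarrow> nat set" where
  "tvars (Var n) = {n}" | "tvars Zero = {}" | "tvars (Plus s t) = tvars s \<union> tvars t"
| "tvars (Fun f t) = tvars t" | "tvars (Par a) = {}"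

fun fsyms :: "('s, 'p) fm \<Rightarrow> 's set" where
  "fsyms (Eq s t) = tsyms s \<union> tsyms t" | "fsyms (Neg \<phi>) = fsyms \<phi>"
| "fsyms (Conj \<phi> \<psi>) = fsyms \<phi> \<union> fsyms \<psi>" | "fsyms (Ex n \<phi>) = fsyms \<phi>"

fun fpars :: "('s, 'p) fm \<Rightarrow> 'p set" where
  "fpars (Eq s t) = tpars s \<union> tpars t" | "fpars (Neg \<phi>) = fpars \<phi>"
| "fpars (Conj \<phi> \<psi>) = fpars \<phi> \<union> fpars \<psi>" | "fpars (Ex n \<phi>) = fpars \<phi>"

fun fv :: "('s, 'p) fm \<Rightarrow> nat set" where
  "fv (Eq s t) = tvars s \<union> tvars t" | "fv (Neg \<phi>) = fv \<phi>"
| "fv (Conj \<phi> \<psi>) = fv \<phi> \<union> fv \<psi>" | "fv (Ex n \<phi>) = fv \<phi> - {n}"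

fun teval :: "('s, 'b) struc \<Rightarrow> ('p \<Rightarrow> 'b) \<Rightarrow> (nat \<Rightarrow> 'b) \<Rightarrow> ('s, 'p) trm \<Rightarrow> 'b" where
  "teval M p e (Var n) = e n"
| "teval M p e Zero = s_zero M"
| "teval M p e (Plus s t) = s_plus M (teval M p e s) (teval M p e t)"
| "teval M p e (Fun f t) = s_fun M f (teval M p e t)"
| "teval M p e (Par a) = p a"

fun sat :: "('s, 'b) struc \<Rightarrow> ('p \<Rightarrow> 'b) \<Rightarrow> (nat \<Rightarrow> 'b) \<Rightarrow> ('s, 'p) fm \<Rightarrow> bool" where
  "sat M p e (Eq s t) = (teval M p e s = teval M p e t)"
| "sat M p e (Neg \<phi>) = (\<not> sat M p e \<phi>)"
| "sat M p e (Conj \<phi> \<psi>) = (sat M p e \<phi> \<and> sat M p e \<psi>)"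
| "sat M p e (Ex n \<phi>) = (\<exists>a. sat M p (e(n := a)) \<phi>)"

text \<open>The near vector space V = (UNIV :: 'v set) as an L_Fnvs-structure.\<close>

definition nvs_struc :: "('v::group_add \<Rightarrow> 'v, 'v) struc" where
  "nvs_struc = \<lparr>s_plus = (+), s_zero = 0, s_fun = (\<lambda>c. c)\<rparr>"

definition in_lang :: "('v \<Rightarrow> 'v) set \<Rightarrow> ('v \<Rightarrow> 'v, 'p) fm \<Rightarrow> bool" where
  "in_lang F \<phi> \<longleftrightarrow> fsyms \<phi> \<subseteq> F"

text \<open>M is a model of T = Th(V): every L_Fnvs-sentence true in V is true in M
  (the universe of M is the whole type 'b).\<close>

definition model_of_Th :: "('v::group_add \<Rightarrow> 'v) set \<Rightarrow> ('v \<Rightarrow> 'v, 'b) struc \<Rightarrow> bool" where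
  "model_of_Th F M \<longleftrightarrow>
     (\<forall>\<phi> :: ('v \<Rightarrow> 'v, nat) fm. in_lang F \<phi> \<and> fv \<phi> = {} \<and> fpars \<phi> = {} \<longrightarrow>
        sat nvs_struc (\<lambda>_. 0) (\<lambda>_. 0) \<phi> \<longrightarrow> sat M (\<lambda>_. undefined) (\<lambda>_. undefined) \<phi>)"

text \<open>Complete 1-types over A (in the variable 0): complete, finitely satisfiable in M
  sets of L_Fnvs(A)-formulas with free variables among {0}.\<close>

definition formulas_over :: "('v \<Rightarrow> 'v) set \<Rightarrow> 'b set \<Rightarrow> ('v \<Rightarrow> 'v, 'b) fm set" where
  "formulas_over F A = {\<phi>. in_lang F \<phi> \<and> fpars \<phi> \<subseteq> A \<and> fv \<phi> \<subseteq> {0}}"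

definition complete_1_types ::
  "('v \<Rightarrow> 'v) set \<Rightarrow> ('v \<Rightarrow> 'v, 'b) struc \<Rightarrow> 'b set \<Rightarrow> ('v \<Rightarrow> 'v, 'b) fm set set" where
  "complete_1_types F M A = {P. P \<subseteq> formulas_over F A
     \<and> (\<forall>\<phi>\<in>formulas_over F A. \<phi> \<in> P \<or> Neg \<phi> \<in> P)
     \<and> (\<forall>Q. finite Q \<and> Q \<subseteq> P \<longrightarrow> (\<exists>a. \<forall>\<phi>\<in>Q. sat M id (\<lambda>_. a) \<phi>))}"

text \<open>Stability of the model M in the cardinal |K|: over every A \<subseteq> M with |A| \<le> |K|
  there are at most |K| complete 1-types.\<close>

definition stable_in ::
  "('v \<Rightarrow> 'v) set \<Rightarrow> ('v \<Rightarrow> 'v, 'b) struc \<Rightarrow> 'c set \<Rightarrow> bool" where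
  "stable_in F M K \<longleftrightarrow> (\<forall>A :: 'b set. A \<lesssim> K \<longrightarrow> complete_1_types F M A \<lesssim> K)"

end

theory Submission
  imports Defs
begin

text \<open>Every nonzero \<open>u \<in> Q(V)\<close> makes \<open>F\<close> a field through
  \<open>\<alpha> u + \<beta> u = (\<alpha> +\<^sub>u \<beta>) u\<close>. This addition is constant on blocks, so finitely many
  additions occur, and by interpolation the projection of \<open>V\<close> onto the vectors with a given
  addition is a sum of scalars. Hence \<open>V\<close>, and by universal equations every model of its theory,
  is cut by finitely many terms into components on which each term acts as a single scalar.
  In such a structure every formula is decided by finitely many conditions
  \<open>proj i t = 0\<close> (a back-and-forth argument), so a type over \<open>A\<close> is determined by the
  equations \<open>proj i x = proj i c\<close> it contains, where \<open>c\<close> ranges over the closed terms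
  over \<open>A\<close>; for each \<open>i\<close> they form the empty set or a single class of closed terms.\<close>

section \<open>Cardinality bounds\<close>

lemma lepoll_iff_ordLeq: "A \<lesssim> B \<longleftrightarrow> ordLeq3 (card_of A) (card_of B)"
  unfolding lepoll_def card_of_ordLeq by simp

lemma times_lepoll_infinite:
  assumes "infinite K" "A \<lesssim> K" "B \<lesssim> K"
  shows "A \<times> B \<lesssim> K"
proof -
  have "K \<times> K \<lesssim> K"
    using card_of_Times_same_infinite[OF assms(1)] ordIso_iff_ordLeq lepoll_iff_ordLeq by blast
  then show ?thesis
    using times_lepoll_mono[OF assms(2,3)] lepoll_trans by blast
qed

lemma UN_lepoll_infinite:
  assumes "infinite K" "I \<lesssim> K" "\<And>i. i \<in> I \<Longrightarrow> A i \<lesssim> K"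
  shows "(\<Union>i\<in>I. A i) \<lesssim> K"
  using card_of_UNION_ordLeq_infinite[OF assms(1), of I A] assms by (simp add: lepoll_iff_ordLeq)

lemma Un_lepoll_infinite:
  assumes "infinite K" "A \<lesssim> K" "B \<lesssim> K"
  shows "A \<union> B \<lesssim> K"
  using UN_lepoll_infinite[OF assms(1), of UNIV "\<lambda>b. if b then A else B"] assms
    finite_lepoll_infinite[OF assms(1), of "UNIV :: bool set"]
  by (simp add: UNIV_bool Un_commute)

lemma PiE_lepoll_infinite:
  assumes "infinite K" "finite I" "\<And>i. i \<in> I \<Longrightarrow> S i \<lesssim> K"
  shows "PiE I S \<lesssim> K"
  using assms(2,3)
proof (induction I rule: finite_induct)
  case empty
  then show ?case by (simp add: finite_lepoll_infinite[OF assms(1)])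
next
  case (insert i I)
  have "S i \<times> PiE I S \<lesssim> K"
    using insert by (intro times_lepoll_infinite[OF assms(1)]) auto
  then show ?case
    unfolding PiE_insert_eq using image_lepoll lepoll_trans by blast
qed

section \<open>Closed terms over a parameter set and their number\<close>

definition terms_over :: "'s set \<Rightarrow> 'p set \<Rightarrow> ('s, 'p) trm set" where
  "terms_over F A = {t. tsyms t \<subseteq> F \<and> tpars t \<subseteq> A}"

text \<open>Layering by term size gives countably many layers. Each arises from the previous one
  through constants, pairs under \<open>Plus\<close> and pairs under \<open>Fun\<close>, and an
  infinite \<open>K\<close> absorbs products and countable unions.\<close>

lemma closed_terms_lepoll:
  fixes F :: "'s set" and A :: "'p set"
  assumes K: "infinite K" and F: "F \<lesssim> K" and A: "A \<lesssim> K"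
  shows "{t \<in> terms_over F A. tvars t = {}} \<lesssim> K"
proof -
  define C where "C n = {t \<in> terms_over F A. tvars t = {} \<and> size t < n}" for n
  have C_le: "C n \<lesssim> K" for n
  proof (induction n)
    case 0
    have "C 0 = {}" by (auto simp: C_def)
    then show ?case by simp
  next
    case (Suc n)
    have sub: "C (Suc n) \<subseteq> insert Zero (Par ` A) \<union>
        ((\<lambda>(s, t). Plus s t) ` (C n \<times> C n) \<union> (\<lambda>(f, t). Fun f t) ` (F \<times> C n))"
    proof
      fix t assume "t \<in> C (Suc n)"
      then show "t \<in> insert Zero (Par ` A) \<union>
        ((\<lambda>(s, t). Plus s t) ` (C n \<times> C n) \<union> (\<lambda>(f, t). Fun f t) ` (F \<times> C n))"
        by (cases t) (auto simp: C_def terms_over_def image_iff)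
    qed
    have 1: "Par ` A \<lesssim> K"
      using image_lepoll A lepoll_trans by blast
    have 2: "(\<lambda>(s, t). Plus s t) ` (C n \<times> C n) \<lesssim> K"
      using image_lepoll times_lepoll_infinite[OF K Suc Suc] lepoll_trans by blast
    have 3: "(\<lambda>(f, t). Fun f t) ` (F \<times> C n) \<lesssim> K"
      using image_lepoll times_lepoll_infinite[OF K F Suc] lepoll_trans by blast
    have "insert Zero (Par ` A) \<lesssim> K"
      using Un_lepoll_infinite[OF K finite_lepoll_infinite[OF K, of "{Zero}"] 1] by simp
    then show ?case
      using Un_lepoll_infinite[OF K _ Un_lepoll_infinite[OF K 2 3]]
        subset_imp_lepoll[OF sub] lepoll_trans by blast
  qed
  have "{t \<in> terms_over F A. tvars t = {}} = (\<Union>n. C n)"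
    by (auto simp: C_def)
  then show ?thesis
    using UN_lepoll_infinite[OF K, of UNIV C] C_le K by (simp add: infinite_le_lepoll)
qed

section \<open>Structures split by finitely many scalar projections\<close>

text \<open>A sum of scalars is in general not a scalar, so it is kept as a list of symbols. Such a
  list can be evaluated in every structure, which lets a projection found in \<open>V\<close> be
  reused in all models.\<close>

fun lincomb :: "('s, 'b) struc \<Rightarrow> 's list \<Rightarrow> 'b \<Rightarrow> 'b" where
  "lincomb M [] x = s_zero M"
| "lincomb M (c # L) x = s_plus M (s_fun M c x) (lincomb M L x)"

fun lincomb_trm :: "'s list \<Rightarrow> ('s, 'p) trm \<Rightarrow> ('s, 'p) trm" where
  "lincomb_trm [] t = Zero"
| "lincomb_trm (c # L) t = Plus (Fun c t) (lincomb_trm L t)"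

lemma teval_lincomb_trm [simp]: "teval M p e (lincomb_trm L t) = lincomb M L (teval M p e t)"
  by (induction L) auto

lemma lincomb_trm_tsyms: "tsyms (lincomb_trm L t) \<subseteq> set L \<union> tsyms t"
  and lincomb_trm_tvars: "tvars (lincomb_trm L t) \<subseteq> tvars t"
  and lincomb_trm_tpars: "tpars (lincomb_trm L t) \<subseteq> tpars t"
  by (induction L) auto

text \<open>Yields the constant part of a term that is affine in the variables of \<open>N\<close>.
  The set \<open>N\<close> is a singleton when a quantifier is eliminated and \<open>UNIV\<close>
  when a type is evaluated under a constant assignment.\<close>

fun zero_vars :: "nat set \<Rightarrow> ('s, 'p) trm \<Rightarrow> ('s, 'p) trm" where
  "zero_vars N (Var n) = (if n \<in> N then Zero else Var n)"
| "zero_vars N Zero = Zero"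
| "zero_vars N (Plus s t) = Plus (zero_vars N s) (zero_vars N t)"
| "zero_vars N (Fun f t) = Fun f (zero_vars N t)"
| "zero_vars N (Par a) = Par a"

lemma zero_vars_simps [simp]:
  "tsyms (zero_vars N t) = tsyms t" "tpars (zero_vars N t) = tpars t"
  "tvars (zero_vars N t) = tvars t - N"
  by (induction t) auto

text \<open>Component \<open>i\<close> is the image of \<open>lincomb M (L i)\<close>. The essential
  law is \<open>proj_plus\<close>: after projection a sum of two scalars acts as one scalar, which
  may depend on \<open>i\<close>. Apart from \<open>proj_sep\<close>, the laws of the operations are
  equations once the scalars are fixed, so they pass from \<open>V\<close> to all models.\<close>

locale split_struc =
  fixes M :: "('s, 'b) struc" and F :: "'s set" and neg zro one :: 's
    and I :: "'i set" and L :: "'i \<Rightarrow> 's list"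
  assumes plus_assoc: "s_plus M (s_plus M x y) w = s_plus M x (s_plus M y w)"
    and plus_comm: "s_plus M x y = s_plus M y x"
    and zero_plus: "s_plus M (s_zero M) x = x"
    and neg_plus: "s_plus M (s_fun M neg x) x = s_zero M"
    and neg: "neg \<in> F" and zro: "zro \<in> F" and one: "one \<in> F"
    and zro_fun: "s_fun M zro x = s_zero M"
    and one_fun: "s_fun M one x = x"
    and fun_plus: "c \<in> F \<Longrightarrow> s_fun M c (s_plus M x y) = s_plus M (s_fun M c x) (s_fun M c y)"
    and fun_fun: "c \<in> F \<Longrightarrow> d \<in> F \<Longrightarrow> \<exists>k\<in>F. \<forall>x. s_fun M c (s_fun M d x) = s_fun M k x"
    and fun_comm: "c \<in> F \<Longrightarrow> d \<in> F \<Longrightarrow> s_fun M c (s_fun M d x) = s_fun M d (s_fun M c x)"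
    and fun_inv: "c \<in> F \<Longrightarrow> c \<noteq> zro \<Longrightarrow> \<exists>d\<in>F. \<forall>x. s_fun M d (s_fun M c x) = x"
    and finite_I: "finite I"
    and L_F: "i \<in> I \<Longrightarrow> set (L i) \<subseteq> F"
    and proj_plus: "i \<in> I \<Longrightarrow> c \<in> F \<Longrightarrow> d \<in> F \<Longrightarrow>
      \<exists>k\<in>F. \<forall>x. lincomb M (L i) (s_plus M (s_fun M c x) (s_fun M d x)) = lincomb M (L i) (s_fun M k x)"
    and proj_idem: "i \<in> I \<Longrightarrow> lincomb M (L i) (lincomb M (L i) x) = lincomb M (L i) x"
    and proj_orth: "i \<in> I \<Longrightarrow> j \<in> I \<Longrightarrow> i \<noteq> j \<Longrightarrow> lincomb M (L i) (lincomb M (L j) x) = s_zero M"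
    and proj_sep: "(\<And>i. i \<in> I \<Longrightarrow> lincomb M (L i) x = s_zero M) \<Longrightarrow> x = s_zero M"
begin

abbreviation pls (infixl "\<oplus>" 65) where "x \<oplus> y \<equiv> s_plus M x y"
abbreviation act (infixr "\<odot>" 70) where "c \<odot> x \<equiv> s_fun M c x"
abbreviation zer ("\<zero>") where "\<zero> \<equiv> s_zero M"
abbreviation proj where "proj i x \<equiv> lincomb M (L i) x"

section \<open>Group laws and the decomposition into components\<close>

lemma plus_zero: "x \<oplus> \<zero> = x"
  using zero_plus plus_comm by metis

lemma plus_left_comm: "x \<oplus> (y \<oplus> w) = y \<oplus> (x \<oplus> w)"
  by (metis plus_assoc plus_comm)

lemmas plus_ac = plus_assoc plus_comm plus_left_comm

lemma plus_left_cancel: "x \<oplus> y = x \<oplus> w \<longleftrightarrow> y = w"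
  by (metis neg_plus plus_assoc zero_plus)

lemma plus_eq_zero_iff: "x \<oplus> y = \<zero> \<longleftrightarrow> x = neg \<odot> y"
  by (metis neg_plus plus_comm plus_left_cancel)

lemma eq_iff_diff: "x = y \<longleftrightarrow> x \<oplus> neg \<odot> y = \<zero>"
  by (metis neg_plus plus_comm plus_left_cancel)

lemma fun_zero: "c \<in> F \<Longrightarrow> c \<odot> \<zero> = \<zero>"
  by (metis fun_plus plus_left_cancel plus_zero)

lemma lincomb_plus: "set X \<subseteq> F \<Longrightarrow> lincomb M X (x \<oplus> y) = lincomb M X x \<oplus> lincomb M X y"
  by (induction X) (auto simp: zero_plus fun_plus plus_ac)

lemma lincomb_zero: "set X \<subseteq> F \<Longrightarrow> lincomb M X \<zero> = \<zero>"
  by (induction X) (auto simp: zero_plus fun_zero)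

lemma lincomb_fun: "set X \<subseteq> F \<Longrightarrow> c \<in> F \<Longrightarrow> lincomb M X (c \<odot> x) = c \<odot> lincomb M X x"
  by (induction X) (auto simp: fun_zero fun_plus fun_comm[of c])

lemma proj_add: "i \<in> I \<Longrightarrow> proj i (x \<oplus> y) = proj i x \<oplus> proj i y"
  and proj_zero: "i \<in> I \<Longrightarrow> proj i \<zero> = \<zero>"
  and proj_fun: "i \<in> I \<Longrightarrow> c \<in> F \<Longrightarrow> proj i (c \<odot> x) = c \<odot> proj i x"
  by (simp_all add: lincomb_plus lincomb_zero lincomb_fun L_F)

lemma eq_iff_proj_eq: "x = y \<longleftrightarrow> (\<forall>i\<in>I. proj i x = proj i y)"
proof
  assume "\<forall>i\<in>I. proj i x = proj i y"
  then have "proj i (x \<oplus> neg \<odot> y) = \<zero>" if "i \<in> I" for i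
    using that by (simp add: proj_add proj_fun neg flip: eq_iff_diff)
  then show "x = y"
    using proj_sep eq_iff_diff by blast
qed simp

lemma proj_surj: "\<exists>x. \<forall>i\<in>I. proj i x = proj i (b i)"
proof -
  have "\<exists>x. \<forall>i\<in>I. proj i x = (if i \<in> J then proj i (b i) else \<zero>)" if "J \<subseteq> I" for J
    using finite_subset[OF that finite_I] that
  proof (induction J rule: finite_induct)
    case empty
    then show ?case using proj_zero by auto
  next
    case (insert j J)
    then obtain x where x: "\<forall>i\<in>I. proj i x = (if i \<in> J then proj i (b i) else \<zero>)"
      by auto
    have "proj i (x \<oplus> proj j (b j)) = (if i \<in> insert j J then proj i (b i) else \<zero>)"
      if "i \<in> I" for i
      using that insert x
      by (cases "i = j") (auto simp: proj_add proj_idem proj_orth zero_plus plus_zero)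
    then show ?case by blast
  qed
  from this[OF subset_refl] show ?thesis by auto
qed

text \<open>Within one component a term is affine in the common value \<open>a\<close> of the
  variables in \<open>N\<close>, with a single scalar as coefficient: \<open>proj_plus\<close>
  merges the coefficients of a sum, \<open>fun_fun\<close> those of nested symbols.\<close>

lemma proj_teval_split:
  assumes i: "i \<in> I" and t: "t \<in> terms_over F A"
  shows "\<exists>c\<in>F. \<forall>e a. proj i (teval M p (\<lambda>m. if m \<in> N then a else e m) t) =
    proj i (c \<odot> a) \<oplus> proj i (teval M p e (zero_vars N t))"
  using t
proof (induction t)
  case (Var m)
  show ?case
  proof (cases "m \<in> N")
    case True
    then show ?thesis by (intro bexI[OF _ one]) (simp add: one_fun proj_zero i plus_zero)
  next
    case False
    then show ?thesis by (intro bexI[OF _ zro]) (simp add: zro_fun proj_zero i zero_plus)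
  qed
next
  case Zero
  show ?case by (auto intro!: bexI[OF _ zro] simp: zro_fun proj_zero i zero_plus)
next
  case (Plus s t)
  then obtain c d where cd: "c \<in> F" "d \<in> F"
    "\<And>e a. proj i (teval M p (\<lambda>m. if m \<in> N then a else e m) s) =
      proj i (c \<odot> a) \<oplus> proj i (teval M p e (zero_vars N s))"
    "\<And>e a. proj i (teval M p (\<lambda>m. if m \<in> N then a else e m) t) =
      proj i (d \<odot> a) \<oplus> proj i (teval M p e (zero_vars N t))"
    by (auto simp: terms_over_def)
  obtain k where "k \<in> F" "\<And>x. proj i (k \<odot> x) = proj i (c \<odot> x) \<oplus> proj i (d \<odot> x)"
    using proj_plus[OF i cd(1,2)] proj_add[OF i] by metis
  with cd show ?case
    by (intro bexI[of _ k]) (auto simp: proj_add i plus_ac)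
next
  case (Fun f t)
  then obtain c where f: "f \<in> F" and c: "c \<in> F"
    "\<And>e a. proj i (teval M p (\<lambda>m. if m \<in> N then a else e m) t) =
      proj i (c \<odot> a) \<oplus> proj i (teval M p e (zero_vars N t))"
    by (auto simp: terms_over_def)
  obtain k where "k \<in> F" "\<And>x. f \<odot> c \<odot> x = k \<odot> x"
    using fun_fun[OF f c(1)] by blast
  with c f show ?case
    by (intro bexI[of _ k]) (auto simp: proj_fun i fun_plus)
next
  case (Par a)
  show ?case by (auto intro!: bexI[OF _ zro] simp: zro_fun proj_zero i zero_plus)
qed

text \<open>A zero coefficient removes \<open>a\<close> from the equation; a nonzero one is
  invertible, and the equation is solved for \<open>proj i a\<close>.\<close>

lemma proj_teval_solve:
  assumes i: "i \<in> I" and t: "t \<in> terms_over F A"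
  shows "\<exists>w\<in>terms_over F A. tvars w \<inter> N = {} \<and>
    ((\<forall>e a. proj i (teval M p (\<lambda>m. if m \<in> N then a else e m) t) = proj i (teval M p e w)) \<or>
     (\<forall>e a. proj i (teval M p (\<lambda>m. if m \<in> N then a else e m) t) = \<zero> \<longleftrightarrow>
        proj i a = proj i (teval M p e w)))"
proof -
  obtain c where c: "c \<in> F" "\<And>e a. proj i (teval M p (\<lambda>m. if m \<in> N then a else e m) t) =
    proj i (c \<odot> a) \<oplus> proj i (teval M p e (zero_vars N t))"
    using proj_teval_split[OF assms] by blast
  let ?t = "zero_vars N t"
  show ?thesis
  proof (cases "c = zro")
    case True
    then show ?thesis
      using c t i by (intro bexI[of _ ?t]) (auto simp: terms_over_def zro_fun proj_zero zero_plus)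
  next
    case False
    then obtain d where d: "d \<in> F" "\<And>x. d \<odot> c \<odot> x = x"
      using fun_inv c(1) by blast
    \<comment> \<open>The left inverse \<open>d\<close> is also a right inverse because scalars
      commute.\<close>
    have "c \<odot> x = y \<longleftrightarrow> x = d \<odot> y" for x y
      using d c(1) fun_comm by metis
    then have "proj i (c \<odot> a) \<oplus> proj i u = \<zero> \<longleftrightarrow> proj i a = proj i (d \<odot> neg \<odot> u)" for a u
      by (simp add: plus_eq_zero_iff proj_fun i c(1) d(1) neg)
    then show ?thesis
      using c t d(1) neg by (intro bexI[of _ "Fun d (Fun neg ?t)"]) (auto simp: terms_over_def)
  qed
qed

section \<open>Quantifier elimination\<close>

text \<open>The conditions \<open>proj i t = 0\<close> act as basic formulas. Comparing assignments
  on finitely many of them allows a semantic form of quantifier elimination, without constructing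
  formulas.\<close>

definition agree :: "('p \<Rightarrow> 'b) \<Rightarrow> ('s, 'p) trm set \<Rightarrow> (nat \<Rightarrow> 'b) \<Rightarrow> (nat \<Rightarrow> 'b) \<Rightarrow> bool" where
  "agree p T e e' \<longleftrightarrow>
    (\<forall>t\<in>T. \<forall>i\<in>I. proj i (teval M p e t) = \<zero> \<longleftrightarrow> proj i (teval M p e' t) = \<zero>)"

text \<open>A component \<open>range (proj i)\<close> may be finite: the forbidden values then exhaust it for
  \<open>g\<close> exactly when they do for \<open>g'\<close>, because both families have the same number of
  distinct values.\<close>

lemma transfer_component:
  assumes W: "finite W" and same: "\<And>s t. s \<in> W \<Longrightarrow> t \<in> W \<Longrightarrow> g s = g t \<longleftrightarrow> g' s = g' t"
    and R: "g ` W \<subseteq> R" "g' ` W \<subseteq> R" "x \<in> R"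
  shows "\<exists>y\<in>R. \<forall>t\<in>W. x = g t \<longleftrightarrow> y = g' t"
proof (cases "x \<in> g ` W")
  case True
  then obtain s where "s \<in> W" "x = g s" by blast
  then show ?thesis using same R by (intro bexI[of _ "g' s"]) auto
next
  case False
  have "\<exists>y\<in>R. y \<notin> g' ` W"
  proof (rule ccontr)
    assume "\<not> ?thesis"
    then have eq: "g' ` W = R" using R by blast
    then have "finite R" using W by auto
    \<comment> \<open>By \<open>same\<close>, sending \<open>g t\<close> to \<open>g' t\<close> is
      well defined and injective.\<close>
    have h: "g' (inv_into W g (g t)) = g' t" if "t \<in> W" for t
      using that same by (meson f_inv_into_f imageI inv_into_into)
    have "bij_betw (g' \<circ> inv_into W g) (g ` W) (g' ` W)"
      unfolding bij_betw_def
    proof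
      show "inj_on (g' \<circ> inv_into W g) (g ` W)"
        using h same by (intro inj_onI) (metis comp_apply imageE)
      show "(g' \<circ> inv_into W g) ` g ` W = g' ` W"
        unfolding image_image comp_apply using h by (rule image_cong[OF refl])
    qed
    then have "card (g ` W) = card R" using eq bij_betw_same_card by metis
    then have "g ` W = R" using R \<open>finite R\<close> card_subset_eq by metis
    then show False using False R by blast
  qed
  then show ?thesis using False by blast
qed

text \<open>One step of the back-and-forth. In each component the conditions on \<open>a\<close> say
  which values \<open>proj i a\<close> takes or avoids; choices made in separate components are
  glued by \<open>proj_surj\<close>. As \<open>T'\<close> is chosen before \<open>e\<close>,
  \<open>e'\<close> and \<open>a\<close>, it serves as the finite set for a quantified
  formula.\<close>

lemma agree_extend:
  fixes p :: "'p \<Rightarrow> 'b"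
  assumes T: "finite T" "T \<subseteq> terms_over F A"
  shows "\<exists>T'. finite T' \<and> T' \<subseteq> terms_over F A \<and>
    (\<forall>e e' a. agree p T' e e' \<longrightarrow> (\<exists>a'. agree p T (e(n := a)) (e'(n := a'))))"
proof -
  define ev where "ev e t = teval M p e t" for e and t :: "('s, 'p) trm"
  have "\<exists>w\<in>terms_over F A.
     (\<forall>e a. proj i (ev (e(n := a)) t) = proj i (ev e w)) \<or>
     (\<forall>e a. proj i (ev (e(n := a)) t) = \<zero> \<longleftrightarrow> proj i a = proj i (ev e w))"
    if "i \<in> I" "t \<in> T" for i t
    using proj_teval_solve[OF that(1), of t A "{n}" p] that T
    by (auto simp: fun_upd_def ev_def)
  then obtain w where w: "\<And>i t. i \<in> I \<Longrightarrow> t \<in> T \<Longrightarrow> w i t \<in> terms_over F A \<and>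
     ((\<forall>e a. proj i (ev (e(n := a)) t) = proj i (ev e (w i t))) \<or>
     (\<forall>e a. proj i (ev (e(n := a)) t) = \<zero> \<longleftrightarrow> proj i a = proj i (ev e (w i t))))"
    by metis
  \<comment> \<open>For these terms the condition in component \<open>i\<close> is an equation for
    \<open>a\<close>; for the rest of \<open>T\<close> it depends on \<open>w i t\<close>
    alone.\<close>
  define W where "W i = {t \<in> T. \<forall>e a. proj i (ev (e(n := a)) t) = \<zero> \<longleftrightarrow>
    proj i a = proj i (ev e (w i t))}" for i
  \<comment> \<open>The terms \<open>w i t\<close> settle the conditions free of \<open>a\<close>;
    their differences settle which of the values to be hit or avoided coincide.\<close>
  define T' where "T' = (\<lambda>(i, t). w i t) ` (I \<times> T) \<union>
    (\<lambda>(i, s, t). Plus (w i s) (Fun neg (w i t))) ` (I \<times> T \<times> T)"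
  have "finite T'" using T finite_I by (simp add: T'_def)
  moreover have "T' \<subseteq> terms_over F A"
    using w neg by (auto simp: T'_def terms_over_def dest!: subsetD) blast+
  moreover have "\<exists>a'. agree p T (e(n := a)) (e'(n := a'))" if agr: "agree p T' e e'" for e e' a
  proof -
    have agr': "proj i (ev e t) = \<zero> \<longleftrightarrow> proj i (ev e' t) = \<zero>" if "t \<in> T'" "i \<in> I" for t i
      using agr that by (auto simp: agree_def ev_def)
    have same: "proj i (ev e (w i s)) = proj i (ev e (w i t)) \<longleftrightarrow>
      proj i (ev e' (w i s)) = proj i (ev e' (w i t))" if "i \<in> I" "s \<in> T" "t \<in> T" for i s t
    proof -
      have "Plus (w i s) (Fun neg (w i t)) \<in> T'"
        using that by (force simp: T'_def)
      from agr'[OF this that(1)] show ?thesis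
        using that neg by (simp add: ev_def proj_add proj_fun flip: eq_iff_diff)
    qed
    have "\<exists>b. \<forall>t\<in>W i. proj i a = proj i (ev e (w i t)) \<longleftrightarrow> proj i b = proj i (ev e' (w i t))"
      if "i \<in> I" for i
    proof -
      \<comment> \<open>Searching inside the image of \<open>proj i\<close> ensures that the value
        found is the projection of some element.\<close>
      have "\<exists>y\<in>range (proj i). \<forall>t\<in>W i. proj i a = proj i (ev e (w i t)) \<longleftrightarrow> y = proj i (ev e' (w i t))"
        using T same[OF that] by (intro transfer_component) (auto simp: W_def)
      then show ?thesis by blast
    qed
    then obtain b where b: "\<And>i t. i \<in> I \<Longrightarrow> t \<in> W i \<Longrightarrow>
      proj i a = proj i (ev e (w i t)) \<longleftrightarrow> proj i (b i) = proj i (ev e' (w i t))"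
      by metis
    obtain a' where a': "\<And>i. i \<in> I \<Longrightarrow> proj i a' = proj i (b i)"
      using proj_surj by blast
    have "proj i (ev (e(n := a)) t) = \<zero> \<longleftrightarrow> proj i (ev (e'(n := a')) t) = \<zero>"
      if "i \<in> I" "t \<in> T" for i t
    proof (cases "t \<in> W i")
      case True
      then show ?thesis using b[OF that(1) True] a'[OF that(1)] by (auto simp: W_def)
    next
      case False
      then have eq: "\<And>e a. proj i (ev (e(n := a)) t) = proj i (ev e (w i t))"
        using w[OF that] that by (auto simp: W_def)
      have "w i t \<in> T'" using that by (force simp: T'_def)
      then show ?thesis using agr' that by (simp add: eq)
    qed
    then show ?thesis by (auto simp: agree_def ev_def)
  qed
  ultimately show ?thesis by blast
qed

text \<open>Induction on \<open>\<phi>\<close>; the quantifier is handled by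
  \<open>agree_extend\<close>, whose one-sided conclusion suffices because \<open>agree\<close> is
  symmetric.\<close>

lemma sat_finitely_determined:
  fixes p :: "'p \<Rightarrow> 'b"
  assumes "fsyms \<phi> \<subseteq> F" "fpars \<phi> \<subseteq> A"
  shows "\<exists>T. finite T \<and> T \<subseteq> terms_over F A \<and>
    (\<forall>e e'. agree p T e e' \<longrightarrow> (sat M p e \<phi> \<longleftrightarrow> sat M p e' \<phi>))"
  using assms
proof (induction \<phi>)
  case (Eq s t)
  have "sat M p e (Eq s t) \<longleftrightarrow> (\<forall>i\<in>I. proj i (teval M p e (Plus s (Fun neg t))) = \<zero>)" for e
    using eq_iff_proj_eq[of "teval M p e (Plus s (Fun neg t))" \<zero>]
      eq_iff_diff[of "teval M p e s" "teval M p e t"] proj_zero by simp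
  then have "agree p {Plus s (Fun neg t)} e e' \<Longrightarrow> sat M p e (Eq s t) \<longleftrightarrow> sat M p e' (Eq s t)" for e e'
    unfolding agree_def by blast
  moreover have "Plus s (Fun neg t) \<in> terms_over F A"
    using Eq neg by (auto simp: terms_over_def)
  ultimately show ?case
    by (intro exI[of _ "{Plus s (Fun neg t)}"]) blast
next
  case (Neg \<phi>)
  then show ?case by auto
next
  case (Conj \<phi> \<psi>)
  then obtain T T' where *: "finite T" "T \<subseteq> terms_over F A" "finite T'" "T' \<subseteq> terms_over F A"
    "\<And>e e'. agree p T e e' \<Longrightarrow> sat M p e \<phi> \<longleftrightarrow> sat M p e' \<phi>"
    "\<And>e e'. agree p T' e e' \<Longrightarrow> sat M p e \<psi> \<longleftrightarrow> sat M p e' \<psi>"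
    by auto
  have "agree p T e e' \<and> agree p T' e e'" if "agree p (T \<union> T') e e'" for e e'
    using that by (auto simp: agree_def)
  with * show ?case by (intro exI[of _ "T \<union> T'"]) (simp, blast)
next
  case (Ex n \<phi>)
  then obtain T where T: "finite T" "T \<subseteq> terms_over F A"
    "\<And>e e'. agree p T e e' \<Longrightarrow> sat M p e \<phi> \<longleftrightarrow> sat M p e' \<phi>"
    by auto
  obtain T' where T': "finite T'" "T' \<subseteq> terms_over F A"
    "\<And>e e' a. agree p T' e e' \<Longrightarrow> \<exists>a'. agree p T (e(n := a)) (e'(n := a'))"
    using agree_extend[OF T(1,2), of p n] by blast
  have sym: "agree p T' e' e" if "agree p T' e e'" for e e'
    using that by (auto simp: agree_def)
  have "\<exists>a'. sat M p (e'(n := a')) \<phi>" if "agree p T' e e'" "sat M p (e(n := a)) \<phi>" for e e' a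
    using T'(3)[OF that(1)] T(3) that(2) by blast
  then show ?case using T' sym by (intro exI[of _ T']) (simp, blast)
qed

end

section \<open>Counting types\<close>

lemma complete_1_types_neg_iff:
  assumes "X \<in> complete_1_types F M A" "\<phi> \<in> formulas_over F A"
  shows "Neg \<phi> \<in> X \<longleftrightarrow> \<phi> \<notin> X"
proof -
  have "\<phi> \<in> X \<or> Neg \<phi> \<in> X"
    and fin_sat: "\<And>Q. finite Q \<Longrightarrow> Q \<subseteq> X \<Longrightarrow> \<exists>a. \<forall>\<psi>\<in>Q. sat M id (\<lambda>_. a) \<psi>"
    using assms by (simp_all add: complete_1_types_def)
  moreover have "\<not> {\<phi>, Neg \<phi>} \<subseteq> X"
    using fin_sat[of "{\<phi>, Neg \<phi>}"] by fastforce
  ultimately show ?thesis by auto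
qed

text \<open>Finite satisfiability is applied to the formulas of \<open>Q\<close>, negated exactly
  where they are missing from \<open>X\<close>.\<close>

lemma complete_1_types_decide:
  assumes X: "X \<in> complete_1_types F M A" and Q: "finite Q" "Q \<subseteq> formulas_over F A"
  shows "\<exists>a. \<forall>\<phi>\<in>Q. sat M id (\<lambda>_. a) \<phi> \<longleftrightarrow> \<phi> \<in> X"
proof -
  let ?Q = "(\<lambda>\<phi>. if \<phi> \<in> X then \<phi> else Neg \<phi>) ` Q"
  have "?Q \<subseteq> X" using complete_1_types_neg_iff[OF X] Q by auto
  then obtain a where a: "\<forall>\<psi>\<in>?Q. sat M id (\<lambda>_. a) \<psi>"
    using X Q unfolding complete_1_types_def by blast
  have "sat M id (\<lambda>_. a) \<phi> \<longleftrightarrow> \<phi> \<in> X" if "\<phi> \<in> Q" for \<phi>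
    using bspec[OF a imageI[OF that]] by (auto split: if_splits)
  then show ?thesis by blast
qed

text \<open>The code \<open>inv X\<close> determines \<open>X\<close> by quantifier elimination.
  Each of its finitely many coordinates is empty or a class of closed terms with equal projection,
  so it has at most \<open>|K|\<close> possible values.\<close>

theorem split_struc_stable_in:
  fixes F :: "('v \<Rightarrow> 'v) set" and M :: "('v \<Rightarrow> 'v, 'b) struc" and K :: "'c set"
  assumes split: "split_struc M F neg zro one I L"
    and K: "infinite K" and FK: "F \<lesssim> K"
  shows "stable_in F M K"
  unfolding stable_in_def
proof (intro allI impI)
  interpret split_struc M F neg zro one I L by fact
  fix A :: "'b set" assume AK: "A \<lesssim> K"
  define C where "C = {t \<in> terms_over F A. tvars t = {}}"
  define eqn where "eqn i c = Eq (lincomb_trm (L i) (Var 0)) (lincomb_trm (L i) c)"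
    for i and c :: "('v \<Rightarrow> 'v, 'b) trm"
  define v where "v c = teval M id (\<lambda>_. s_zero M) c" for c :: "('v \<Rightarrow> 'v, 'b) trm"
  define cls where "cls i c = {d \<in> C. proj i (v d) = proj i (v c)}" for i c
  define inv where "inv X = (\<lambda>i\<in>I. {c \<in> C. eqn i c \<in> X})" for X
  have ev_C: "teval M id e c = v c" if "c \<in> C" for e c
  proof -
    have "tvars c = {} \<Longrightarrow> teval M id e c = v c"
      by (induction c) (auto simp: v_def)
    then show ?thesis using that by (simp add: C_def)
  qed
  have sat_eqn: "sat M id e (eqn i c) \<longleftrightarrow> proj i (e 0) = proj i (v c)" if "c \<in> C" for e i c
    using that by (simp add: eqn_def ev_C)
  have eqn_over: "eqn i c \<in> formulas_over F A" if "i \<in> I" "c \<in> C" for i c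
  proof -
    have "tsyms (lincomb_trm (L i) t) \<subseteq> F" if "tsyms t \<subseteq> F" for t :: "('v \<Rightarrow> 'v, 'b) trm"
      using lincomb_trm_tsyms[of "L i" t] L_F[OF \<open>i \<in> I\<close>] that by blast
    moreover have "tvars c = {}" "tsyms c \<subseteq> F" "tpars c \<subseteq> A"
      using \<open>c \<in> C\<close> by (auto simp: C_def terms_over_def)
    ultimately show ?thesis
      using lincomb_trm_tvars[of "L i" c] lincomb_trm_tpars[of "L i" c]
        lincomb_trm_tvars[of "L i" "Var 0 :: ('v \<Rightarrow> 'v, 'b) trm"]
        lincomb_trm_tpars[of "L i" "Var 0 :: ('v \<Rightarrow> 'v, 'b) trm"]
      by (simp add: eqn_def formulas_over_def in_lang_def)
  qed
  have "inj_on inv (complete_1_types F M A)"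
  proof (rule inj_onI)
    have sub: "X \<subseteq> Y" if X: "X \<in> complete_1_types F M A" and Y: "Y \<in> complete_1_types F M A"
      and "inv X = inv Y" for X Y
    proof
      fix \<phi> assume \<phi>: "\<phi> \<in> X"
      then have \<phi>_over: "\<phi> \<in> formulas_over F A" using X by (auto simp: complete_1_types_def)
      have same: "eqn i c \<in> X \<longleftrightarrow> eqn i c \<in> Y" if "i \<in> I" "c \<in> C" for i c
        using fun_cong[OF \<open>inv X = inv Y\<close>, of i] that by (auto simp: inv_def)
      obtain T where T: "finite T" "T \<subseteq> terms_over F A"
        "\<And>e e'. agree id T e e' \<Longrightarrow> sat M id e \<phi> \<longleftrightarrow> sat M id e' \<phi>"
        using sat_finitely_determined[of \<phi> A id] \<phi>_over by (auto simp: formulas_over_def in_lang_def)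
      have "\<exists>w\<in>C. (\<forall>a. proj i (teval M id (\<lambda>_. a) t) = proj i (v w)) \<or>
        (\<forall>a. proj i (teval M id (\<lambda>_. a) t) = \<zero> \<longleftrightarrow> proj i a = proj i (v w))"
        if "i \<in> I" "t \<in> T" for i t
      proof -
        \<comment> \<open>The type is evaluated under constant assignments, so \<open>N\<close> can
          be \<open>UNIV\<close>, which forces \<open>w\<close> to be closed.\<close>
        obtain w where "w \<in> terms_over F A" "tvars w = {}"
          "(\<forall>e a. proj i (teval M id (\<lambda>_. a) t) = proj i (teval M id e w)) \<or>
           (\<forall>e a. proj i (teval M id (\<lambda>_. a) t) = \<zero> \<longleftrightarrow> proj i a = proj i (teval M id e w))"
          using proj_teval_solve[OF \<open>i \<in> I\<close> subsetD[OF T(2) \<open>t \<in> T\<close>], of UNIV id] by auto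
        then show ?thesis unfolding C_def v_def by blast
      qed
      then obtain w where w: "\<And>i t. i \<in> I \<Longrightarrow> t \<in> T \<Longrightarrow> w i t \<in> C \<and>
        ((\<forall>a. proj i (teval M id (\<lambda>_. a) t) = proj i (v (w i t))) \<or>
        (\<forall>a. proj i (teval M id (\<lambda>_. a) t) = \<zero> \<longleftrightarrow> proj i a = proj i (v (w i t))))"
        by metis
      \<comment> \<open>Elements mirroring \<open>X\<close> and \<open>Y\<close> on \<open>Q\<close>
        satisfy the same equations \<open>eqn i (w i t)\<close>, hence agree on \<open>T\<close> and
        on \<open>\<phi>\<close>.\<close>
      define Q where "Q = insert \<phi> ((\<lambda>(i, t). eqn i (w i t)) ` (I \<times> T))"
      have Q: "finite Q" "Q \<subseteq> formulas_over F A"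
        using T(1) finite_I \<phi>_over eqn_over w by (auto simp: Q_def)
      obtain a where a: "\<And>\<psi>. \<psi> \<in> Q \<Longrightarrow> sat M id (\<lambda>_. a) \<psi> \<longleftrightarrow> \<psi> \<in> X"
        using complete_1_types_decide[OF X Q] by blast
      obtain b where b: "\<And>\<psi>. \<psi> \<in> Q \<Longrightarrow> sat M id (\<lambda>_. b) \<psi> \<longleftrightarrow> \<psi> \<in> Y"
        using complete_1_types_decide[OF Y Q] by blast
      have "proj i (teval M id (\<lambda>_. a) t) = \<zero> \<longleftrightarrow> proj i (teval M id (\<lambda>_. b) t) = \<zero>"
        if it: "i \<in> I" "t \<in> T" for i t
      proof -
        have "eqn i (w i t) \<in> Q" using it by (force simp: Q_def)
        then have "proj i a = proj i (v (w i t)) \<longleftrightarrow> proj i b = proj i (v (w i t))"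
          using a b same w[OF it] it sat_eqn by metis
        then show ?thesis using w[OF it] by metis
      qed
      then have "agree id T (\<lambda>_. a) (\<lambda>_. b)" by (simp add: agree_def)
      then show "\<phi> \<in> Y" using T(3) a[of \<phi>] b[of \<phi>] \<phi> by (simp add: Q_def)
    qed
    show "X = Y" if "X \<in> complete_1_types F M A" "Y \<in> complete_1_types F M A" "inv X = inv Y" for X Y
      using sub that by (metis subset_antisym)
  qed
  moreover have "inv ` complete_1_types F M A \<subseteq> (\<Pi>\<^sub>E i\<in>I. insert {} (cls i ` C))"
  proof (rule image_subsetI)
    fix X assume X: "X \<in> complete_1_types F M A"
    have "{c \<in> C. eqn i c \<in> X} \<in> insert {} (cls i ` C)" if i: "i \<in> I" for i
    proof (cases "{c \<in> C. eqn i c \<in> X} = {}")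
      case False
      then obtain c where c: "c \<in> C" "eqn i c \<in> X" by blast
      \<comment> \<open>For an element satisfying \<open>eqn i c\<close>, the truth of
        \<open>eqn i d\<close> depends only on the closed terms \<open>c\<close> and
        \<open>d\<close>.\<close>
      have "eqn i d \<in> X \<longleftrightarrow> proj i (v d) = proj i (v c)" if "d \<in> C" for d
      proof -
        have "finite {eqn i c, eqn i d}" "{eqn i c, eqn i d} \<subseteq> formulas_over F A"
          using eqn_over[OF i c(1)] eqn_over[OF i that] by simp_all
        from complete_1_types_decide[OF X this] obtain a
          where "sat M id (\<lambda>_. a) (eqn i c) \<longleftrightarrow> eqn i c \<in> X"
            "sat M id (\<lambda>_. a) (eqn i d) \<longleftrightarrow> eqn i d \<in> X"
          by blast
        then show ?thesis
          unfolding sat_eqn[OF c(1)] sat_eqn[OF that] using c(2) by auto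
      qed
      then have "{c \<in> C. eqn i c \<in> X} = cls i c" by (auto simp: cls_def)
      with c show ?thesis by blast
    qed simp
    then show "inv X \<in> (\<Pi>\<^sub>E i\<in>I. insert {} (cls i ` C))" by (auto simp: inv_def)
  qed
  moreover have "(\<Pi>\<^sub>E i\<in>I. insert {} (cls i ` C)) \<lesssim> K"
  proof (rule PiE_lepoll_infinite[OF K finite_I])
    fix i assume "i \<in> I"
    have "cls i ` C \<lesssim> K"
      using image_lepoll closed_terms_lepoll[OF K FK AK] lepoll_trans unfolding C_def by blast
    from Un_lepoll_infinite[OF K finite_lepoll_infinite[OF K, of "{{}}"] this]
    show "insert {} (cls i ` C) \<lesssim> K" by simp
  qed
  ultimately show "complete_1_types F M A \<lesssim> K"
    by (meson lepoll_def lepoll_trans)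
qed

section \<open>Additions induced on the scalars\<close>

locale comm_nvs =
  fixes F :: "('v::group_add \<Rightarrow> 'v) set"
  assumes nvs: "near_vector_space F" and comm: "commutative_nvs F"
begin

text \<open>The graph of the addition \<open>+\<^sub>u\<close>. As a set of triples it can be
  compared between vectors and later serves as the index of a component.\<close>

definition induced_add :: "'v \<Rightarrow> (('v \<Rightarrow> 'v) \<times> ('v \<Rightarrow> 'v) \<times> ('v \<Rightarrow> 'v)) set" where
  "induced_add u = {(\<alpha>, \<beta>, \<gamma>). \<alpha> \<in> F \<and> \<beta> \<in> F \<and> \<gamma> \<in> F \<and> \<alpha> u + \<beta> u = \<gamma> u}"

abbreviation Q where "Q \<equiv> quasi_kernel F - {0}"

section \<open>Elementary laws of the scalars and of the group\<close>

lemma zero_in: "zero_map \<in> F" and id_in: "id \<in> F" and uminus_in: "uminus \<in> F"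
  and gen: "gen_subgroup (quasi_kernel F) = UNIV"
  and scal_add: "\<alpha> \<in> F \<Longrightarrow> \<alpha> (x + y) = \<alpha> x + \<alpha> y"
  and scal_inv: "\<alpha> \<in> F \<Longrightarrow> \<alpha> \<noteq> zero_map \<Longrightarrow> bij \<alpha> \<and> inv \<alpha> \<in> F"
  and scal_comp_nonzero: "\<alpha> \<in> F \<Longrightarrow> \<beta> \<in> F \<Longrightarrow> \<alpha> \<noteq> zero_map \<Longrightarrow> \<beta> \<noteq> zero_map \<Longrightarrow> \<alpha> \<circ> \<beta> \<in> F"
  using nvs by (simp_all add: near_vector_space_def)

lemma scal_eqD:
  assumes "\<alpha> \<in> F" "\<beta> \<in> F" "\<alpha> x = \<beta> x" "x \<noteq> 0"
  shows "\<alpha> = \<beta>"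
proof -
  have "\<forall>\<alpha>\<in>F. \<forall>\<beta>\<in>F. \<forall>x. \<alpha> x = \<beta> x \<longrightarrow> \<alpha> = \<beta> \<or> x = 0"
    using nvs by (simp add: near_vector_space_def)
  with assms show ?thesis by blast
qed

lemma scal_comm: "\<alpha> \<in> F \<Longrightarrow> \<beta> \<in> F \<Longrightarrow> \<alpha> (\<beta> x) = \<beta> (\<alpha> x)"
  using comm unfolding commutative_nvs_def by blast

lemma scal_zero: "\<alpha> \<in> F \<Longrightarrow> \<alpha> 0 = 0"
  using scal_add[of \<alpha> 0 0] add_left_cancel[of "\<alpha> 0" "\<alpha> 0" 0] by simp

lemma scal_comp:
  assumes "\<alpha> \<in> F" "\<beta> \<in> F"
  shows "\<alpha> \<circ> \<beta> \<in> F"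
proof (cases "\<alpha> = zero_map \<or> \<beta> = zero_map")
  case True
  then have "\<alpha> \<circ> \<beta> = zero_map"
    using scal_zero[OF assms(1)] by (auto simp: zero_map_def fun_eq_iff)
  then show ?thesis using zero_in by simp
next
  case False
  then show ?thesis using scal_comp_nonzero assms by blast
qed

text \<open>\<open>uminus\<close> is a scalar, hence additive, which forces commutativity.\<close>

lemma add_comm: "x + y = y + (x :: 'v)"
  using scal_add[OF uminus_in, of "- y" "- x"] by (simp add: minus_add)

lemma add_left_comm: "x + (y + z) = y + (x + (z :: 'v))"
  by (metis add.assoc add_comm)

lemmas plus_ac = add.assoc add_comm add_left_comm

lemma scal_eq_zero: "\<alpha> \<in> F \<Longrightarrow> \<alpha> x = 0 \<Longrightarrow> x \<noteq> 0 \<Longrightarrow> \<alpha> = zero_map"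
  using scal_eqD[OF _ zero_in] by (simp add: zero_map_def)

lemma scal_inv_eq: "\<alpha> \<in> F \<Longrightarrow> \<alpha> \<noteq> zero_map \<Longrightarrow> inv \<alpha> (\<alpha> x) = x"
  using scal_inv[of \<alpha>] by (simp add: bij_is_inj)

lemma quasi_kernel_add: "u \<in> Q \<Longrightarrow> \<alpha> \<in> F \<Longrightarrow> \<beta> \<in> F \<Longrightarrow> \<exists>\<gamma>\<in>F. \<alpha> u + \<beta> u = \<gamma> u"
  unfolding quasi_kernel_def by blast

lemma induced_add_total: "u \<in> Q \<Longrightarrow> \<alpha> \<in> F \<Longrightarrow> \<beta> \<in> F \<Longrightarrow> \<exists>\<gamma>\<in>F. (\<alpha>, \<beta>, \<gamma>) \<in> induced_add u"
  using quasi_kernel_add by (fastforce simp: induced_add_def)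

lemma induced_add_unique:
  "u \<noteq> 0 \<Longrightarrow> (\<alpha>, \<beta>, \<gamma>) \<in> induced_add u \<Longrightarrow> (\<alpha>, \<beta>, \<delta>) \<in> induced_add u \<Longrightarrow> \<gamma> = \<delta>"
  using scal_eqD[of \<gamma> \<delta> u] by (auto simp: induced_add_def)

text \<open>The scalar \<open>c\<close> commutes with all scalars and is injective, so it can be
  pulled out of the defining equation and cancelled.\<close>

lemma induced_add_scal:
  assumes c: "c \<in> F" "c \<noteq> zero_map"
  shows "induced_add (c u) = induced_add u"
proof -
  have "\<alpha> (c u) + \<beta> (c u) = \<gamma> (c u) \<longleftrightarrow> \<alpha> u + \<beta> u = \<gamma> u"
    if "\<alpha> \<in> F" "\<beta> \<in> F" "\<gamma> \<in> F" for \<alpha> \<beta> \<gamma>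
  proof -
    have "\<alpha> (c u) + \<beta> (c u) = c (\<alpha> u + \<beta> u)" "\<gamma> (c u) = c (\<gamma> u)"
      using that c by (simp_all add: scal_add scal_comm[of _ c])
    then show ?thesis using scal_inv_eq[OF c] by metis
  qed
  then show ?thesis unfolding induced_add_def by blast
qed

text \<open>Both relations are total on pairs of scalars, so agreement of their values makes them
  equal.\<close>

lemma induced_add_eqI:
  assumes u: "u \<in> Q" and v: "v \<in> Q"
    and eq: "\<And>\<alpha> \<beta> \<gamma> \<delta>. (\<alpha>, \<beta>, \<gamma>) \<in> induced_add u \<Longrightarrow> (\<alpha>, \<beta>, \<delta>) \<in> induced_add v \<Longrightarrow> \<gamma> = \<delta>"
  shows "induced_add u = induced_add v"
proof -
  have in_F: "\<alpha> \<in> F \<and> \<beta> \<in> F" if "(\<alpha>, \<beta>, \<gamma>) \<in> induced_add x" for \<alpha> \<beta> \<gamma> x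
    using that by (auto simp: induced_add_def)
  have "(\<alpha>, \<beta>, \<gamma>) \<in> induced_add u \<longleftrightarrow> (\<alpha>, \<beta>, \<gamma>) \<in> induced_add v" for \<alpha> \<beta> \<gamma>
    using induced_add_total[OF u, of \<alpha> \<beta>] induced_add_total[OF v, of \<alpha> \<beta>] in_F eq by metis
  then show ?thesis by auto
qed

lemma quasi_kernel_scal:
  assumes u: "u \<in> Q" and c: "c \<in> F" "c \<noteq> zero_map"
  shows "c u \<in> Q"
proof -
  have "c u \<noteq> 0" using scal_eq_zero[OF c(1)] c(2) u by blast
  moreover have "\<exists>\<gamma>\<in>F. \<alpha> (c u) + \<beta> (c u) = \<gamma> (c u)" if "\<alpha> \<in> F" "\<beta> \<in> F" for \<alpha> \<beta>
  proof -
    obtain \<gamma> where "\<gamma> \<in> F" "(\<alpha>, \<beta>, \<gamma>) \<in> induced_add u"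
      using induced_add_total[OF u \<open>\<alpha> \<in> F\<close> \<open>\<beta> \<in> F\<close>] by blast
    then show ?thesis
      unfolding induced_add_scal[OF c, symmetric, of u] by (auto simp: induced_add_def)
  qed
  ultimately show ?thesis by (auto simp: quasi_kernel_def)
qed

text \<open>If \<open>\<alpha> +\<^sub>u \<beta> \<noteq> \<alpha> +\<^sub>w \<beta>\<close> with \<open>w = c v\<close>, then expanding
  \<open>\<alpha> (u + w) + \<beta> (u + w) = \<gamma> (u + w)\<close> produces a nonzero common multiple
  \<open>\<eta> u = \<theta> w\<close>, and proportional vectors induce the same addition.\<close>

lemma block_rel_induced_add:
  assumes "(u, v) \<in> block_rel F"
  shows "induced_add u = induced_add v"
proof -
  obtain c where c: "c \<in> F" "c \<noteq> zero_map" and u: "u \<in> Q" and v: "v \<in> Q"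
    and q: "u + c v \<in> quasi_kernel F"
    using assms unfolding block_rel_def by blast
  define w where "w = c v"
  have w: "w \<in> Q" using quasi_kernel_scal[OF v c] by (simp add: w_def)
  have "induced_add u = induced_add w"
  proof (rule induced_add_eqI[OF u w])
    fix \<alpha> \<beta> \<delta> \<epsilon>
    assume \<delta>: "(\<alpha>, \<beta>, \<delta>) \<in> induced_add u" and \<epsilon>: "(\<alpha>, \<beta>, \<epsilon>) \<in> induced_add w"
    then have F: "\<alpha> \<in> F" "\<beta> \<in> F" "\<delta> \<in> F" "\<epsilon> \<in> F" by (auto simp: induced_add_def)
    obtain \<gamma> where \<gamma>: "\<gamma> \<in> F" "\<alpha> (u + w) + \<beta> (u + w) = \<gamma> (u + w)"
      using q F unfolding quasi_kernel_def w_def by blast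
    have "\<alpha> (u + w) + \<beta> (u + w) = (\<alpha> u + \<beta> u) + (\<alpha> w + \<beta> w)"
      by (simp add: scal_add F plus_ac)
    also have "\<dots> = \<delta> u + \<epsilon> w" using \<delta> \<epsilon> by (simp add: induced_add_def)
    finally have eq: "\<delta> u + \<epsilon> w = \<gamma> u + \<gamma> w" using \<gamma> by (simp add: scal_add)
    have eq': "\<delta> u + - \<gamma> u = \<gamma> w + - \<epsilon> w"
    proof -
      have "\<delta> u = \<gamma> u + (\<gamma> w + - \<epsilon> w)"
        using eq by (metis add.assoc add_diff_cancel diff_conv_add_uminus)
      then have "\<delta> u + - \<gamma> u = - \<gamma> u + (\<gamma> u + (\<gamma> w + - \<epsilon> w))"
        by (metis add_comm)
      then show ?thesis by (simp only: minus_add_cancel)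
    qed
    obtain \<eta> where \<eta>: "\<eta> \<in> F" "\<delta> u + - \<gamma> u = \<eta> u"
      using quasi_kernel_add[OF u F(3) scal_comp[OF uminus_in \<gamma>(1)]] by auto
    obtain \<theta> where \<theta>: "\<theta> \<in> F" "\<gamma> w + - \<epsilon> w = \<theta> w"
      using quasi_kernel_add[OF w \<gamma>(1) scal_comp[OF uminus_in F(4)]] by auto
    have "\<eta> u = \<theta> w" using eq' \<eta> \<theta> by simp
    show "\<delta> = \<epsilon>"
    \<comment> \<open>If the common multiple is zero, both values equal \<open>\<gamma>\<close>;
      otherwise \<open>u\<close> and \<open>w\<close> have a common nonzero multiple and share one
      addition.\<close>
    proof (cases "\<eta> u = 0")
      case True
      then have "\<delta> u = \<gamma> u" "\<gamma> w = \<epsilon> w"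
        using \<eta>(2) \<theta>(2) \<open>\<eta> u = \<theta> w\<close> by (simp_all add: eq_neg_iff_add_eq_0[symmetric])
      then show ?thesis using scal_eqD F \<gamma>(1) u w by blast
    next
      case False
      then have "\<eta> \<noteq> zero_map" "\<theta> \<noteq> zero_map"
        using \<open>\<eta> u = \<theta> w\<close> by (auto simp: zero_map_def)
      then have "induced_add u = induced_add w"
        using induced_add_scal \<eta>(1) \<theta>(1) \<open>\<eta> u = \<theta> w\<close> by metis
      then show ?thesis using induced_add_unique \<delta> \<epsilon> w by blast
    qed
  qed
  then show ?thesis using induced_add_scal[OF c] by (simp add: w_def)
qed

text \<open>The induced addition is constant along the equivalence closure of
  \<open>block_rel\<close>, so it factors through the blocks; \<open>the_elem\<close> reads off its
  value on a class.\<close>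

lemma finite_induced_add:
  assumes "finite (blocks F)"
  shows "finite (induced_add ` Q)"
proof -
  let ?R = "(block_rel F \<union> (block_rel F)\<inverse>)\<^sup>*"
  have same: "induced_add u = induced_add v" if "(u, v) \<in> ?R" for u v
    using that by (induction rule: rtrancl_induct) (auto dest: block_rel_induced_add)
  have "induced_add u \<in> (\<lambda>X. the_elem (induced_add ` X)) ` blocks F" if "u \<in> Q" for u
  proof -
    have "induced_add ` (?R `` {u}) = {induced_add u}"
      using same[of u] by auto
    then have "induced_add u = the_elem (induced_add ` (?R `` {u}))" by simp
    moreover have "?R `` {u} \<in> blocks F"
      unfolding blocks_def using that by (rule quotientI)
    ultimately show ?thesis by blast
  qed
  then show ?thesis
    using assms by (meson finite_imageI finite_subset image_subsetI)
qed

section \<open>Projections onto the components are combinations of scalars\<close>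

abbreviation lc where "lc \<equiv> lincomb (nvs_struc :: ('v \<Rightarrow> 'v, 'v) struc)"

lemma nvs_struc_simps [simp]:
  "s_plus nvs_struc = (+)" "s_zero nvs_struc = 0" "s_fun nvs_struc c = c"
  by (simp_all add: nvs_struc_def)

lemma lc_append: "lc (X @ Y) x = lc X x + lc Y x"
  by (induction X) (auto simp: add.assoc)

lemma lc_comp: "lc (map (\<lambda>c. c \<circ> d) X) x = lc X (d x)"
  by (induction X) auto

lemma lc_add: "set X \<subseteq> F \<Longrightarrow> lc X (x + y) = lc X x + lc X y"
  by (induction X) (auto simp: scal_add plus_ac)

lemma lc_zero: "set X \<subseteq> F \<Longrightarrow> lc X 0 = 0"
  by (induction X) (auto simp: scal_zero)

lemma lc_scal: "set X \<subseteq> F \<Longrightarrow> c \<in> F \<Longrightarrow> lc X (c x) = c (lc X x)"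
  by (induction X) (auto simp: scal_zero scal_add scal_comm[of c])

text \<open>The list of all products represents the composite of two sums of scalars. Since the
  factors commute, the composite kills whatever either factor kills.\<close>

lemma lc_prod:
  assumes "set X \<subseteq> F" "set Y \<subseteq> F"
  shows "lc (concat (map (\<lambda>d. map (\<lambda>c. c \<circ> d) X) Y)) x = lc X (lc Y x)"
    and "lc X (lc Y x) = lc Y (lc X x)"
  using assms(2)
  by (induction Y) (auto simp: lc_append lc_comp lc_add lc_zero lc_scal assms(1))

text \<open>The quasi-kernel generates the group, so identities between sums of scalars need
  checking only on \<open>Q\<close>.\<close>

lemma additive_eqI:
  assumes f: "\<And>x y. f (x + y) = f x + f y" and g: "\<And>x y. g (x + y) = g x + (g y :: 'v)"
    and eq: "\<And>u. u \<in> Q \<Longrightarrow> f u = g u"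
  shows "f x = g x"
proof -
  have zero: "f 0 = 0" "g 0 = 0" 
    using f[of 0 0] g[of 0 0] add_left_cancel[of "f 0" "f 0" 0] add_left_cancel[of "g 0" "g 0" 0]
    by simp_all
  have minus: "f (- y) = - f y" "g (- y) = - g y" for y
    using f[of "- y" y] g[of "- y" y] zero by (simp_all add: eq_neg_iff_add_eq_0)
  have "x \<in> gen_subgroup (quasi_kernel F)" by (simp add: gen)
  then show ?thesis
  proof induction
    case (gen_base x)
    then show ?case using eq zero by (cases "x = 0") auto
  qed (simp_all add: f g zero minus)
qed

text \<open>A factor of Lagrange interpolation. If the additions of \<open>u\<close> and
  \<open>v\<close> give \<open>\<gamma> \<noteq> \<delta>\<close> on the pair
  \<open>\<alpha>\<close>, \<open>\<beta>\<close>, then \<open>\<alpha> + \<beta> - \<delta>\<close>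
  kills the vectors with the addition of \<open>v\<close> and acts as a nonzero scalar
  \<open>\<epsilon>\<close> on those with the addition of \<open>u\<close>; dividing by
  \<open>\<epsilon>\<close> gives the combination.\<close>

lemma separate_two:
  assumes u: "u \<in> Q" and v: "v \<in> Q" and ne: "induced_add u \<noteq> induced_add v"
  shows "\<exists>X. set X \<subseteq> F \<and> (\<forall>x\<in>Q. induced_add x = induced_add u \<longrightarrow> lc X x = x) \<and>
    (\<forall>x\<in>Q. induced_add x = induced_add v \<longrightarrow> lc X x = 0)"
proof -
  obtain \<alpha> \<beta> \<gamma> \<delta> where \<gamma>: "(\<alpha>, \<beta>, \<gamma>) \<in> induced_add u" and \<delta>: "(\<alpha>, \<beta>, \<delta>) \<in> induced_add v"
    and "\<gamma> \<noteq> \<delta>"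
    using induced_add_eqI[OF u v] ne by blast
  then have F: "\<alpha> \<in> F" "\<beta> \<in> F" "\<gamma> \<in> F" "\<delta> \<in> F" by (auto simp: induced_add_def)
  let ?\<delta> = "uminus \<circ> \<delta>"
  obtain \<epsilon> where \<epsilon>: "(\<gamma>, ?\<delta>, \<epsilon>) \<in> induced_add u" "\<epsilon> \<in> F"
    using induced_add_total[OF u F(3) scal_comp[OF uminus_in F(4)]] by blast
  have "\<epsilon> \<noteq> zero_map"
  proof
    assume "\<epsilon> = zero_map"
    then have "\<gamma> u = \<delta> u"
      using \<epsilon> by (simp add: induced_add_def zero_map_def eq_neg_iff_add_eq_0[symmetric])
    then show False using scal_eqD F u \<open>\<gamma> \<noteq> \<delta>\<close> by blast
  qed
  note inv = scal_inv[OF \<epsilon>(2) this] scal_inv_eq[OF \<epsilon>(2) this]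
  let ?X = "map (\<lambda>c. inv \<epsilon> \<circ> c) [\<alpha>, \<beta>, ?\<delta>]"
  have lc_X: "lc ?X x = inv \<epsilon> (\<alpha> x + \<beta> x + - \<delta> x)" for x
    using inv(1) by (simp add: scal_add add.assoc del: add_uminus_conv_diff)
  have "lc ?X x = x" if "induced_add x = induced_add u" for x
  proof -
    have "\<alpha> x + \<beta> x + - \<delta> x = \<epsilon> x"
      using \<gamma> \<epsilon>(1) unfolding that[symmetric] by (simp add: induced_add_def)
    then show ?thesis using lc_X inv(2) by simp
  qed
  moreover have "lc ?X x = 0" if "induced_add x = induced_add v" for x
  proof -
    have "\<alpha> x + \<beta> x + - \<delta> x = 0"
      using \<delta> unfolding that[symmetric] by (simp add: induced_add_def)
    then show ?thesis using lc_X scal_zero inv(1) by simp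
  qed
  moreover have "set ?X \<subseteq> F"
    using F inv(1) uminus_in scal_comp by simp
  ultimately show ?thesis by blast
qed

text \<open>The interpolation product, with one factor from \<open>separate_two\<close> for each
  addition in \<open>J\<close>.\<close>

lemma separate_finite:
  assumes u: "u \<in> Q" and J: "finite J" "J \<subseteq> induced_add ` Q" "induced_add u \<notin> J"
  shows "\<exists>X. set X \<subseteq> F \<and> (\<forall>x\<in>Q. induced_add x = induced_add u \<longrightarrow> lc X x = x) \<and>
    (\<forall>x\<in>Q. induced_add x \<in> J \<longrightarrow> lc X x = 0)"
  using J
proof (induction J rule: finite_induct)
  case empty
  have "set [id] \<subseteq> F" "lc [id] x = x" for x using id_in by auto
  then show ?case by blast
next
  case (insert j J)
  then have J: "J \<subseteq> induced_add ` Q" "induced_add u \<notin> J" by simp_all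
  obtain X where X: "set X \<subseteq> F" "\<And>x. x \<in> Q \<Longrightarrow> induced_add x = induced_add u \<Longrightarrow> lc X x = x"
    "\<And>x. x \<in> Q \<Longrightarrow> induced_add x \<in> J \<Longrightarrow> lc X x = 0"
    using insert.IH[OF J] by blast
  obtain v where v: "v \<in> Q" "j = induced_add v" using insert.prems by blast
  then have "induced_add u \<noteq> induced_add v" using insert.prems by auto
  then obtain Y where Y: "set Y \<subseteq> F"
    "\<And>x. x \<in> Q \<Longrightarrow> induced_add x = induced_add u \<Longrightarrow> lc Y x = x"
    "\<And>x. x \<in> Q \<Longrightarrow> induced_add x = j \<Longrightarrow> lc Y x = 0"
    using separate_two[OF u v(1)] v(2) by blast
  let ?Z = "concat (map (\<lambda>d. map (\<lambda>c. c \<circ> d) X) Y)"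
  note lc_Z = lc_prod[OF X(1) Y(1)]
  have "set ?Z \<subseteq> F" using X(1) Y(1) scal_comp by auto
  moreover have "lc ?Z x = x" if "x \<in> Q" "induced_add x = induced_add u" for x
    using that X Y by (simp add: lc_Z(1))
  moreover have "lc ?Z x = 0" if x: "x \<in> Q" "induced_add x \<in> insert j J" for x
  proof (cases "induced_add x = j")
    case True
    then show ?thesis using x Y X(1) by (simp add: lc_Z(1) lc_zero)
  next
    case False
    \<comment> \<open>The list \<open>?Z\<close> applies \<open>Y\<close> first, so the factors are
      interchanged to let \<open>X\<close> annihilate \<open>x\<close>.\<close>
    then have "lc X x = 0" using x X(3) by simp
    then show ?thesis using Y(1) by (simp add: lc_Z lc_zero)
  qed
  ultimately show ?case by blast
qed

lemma exists_projections:
  assumes "finite (blocks F)"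
  shows "\<exists>L. \<forall>i\<in>induced_add ` Q. set (L i) \<subseteq> F \<and>
    (\<forall>x\<in>Q. lc (L i) x = (if induced_add x = i then x else 0))"
proof -
  have "\<exists>X. set X \<subseteq> F \<and> (\<forall>x\<in>Q. lc X x = (if induced_add x = i then x else 0))"
    if i: "i \<in> induced_add ` Q" for i
  proof -
    obtain u where u: "u \<in> Q" "i = induced_add u" using i by blast
    let ?J = "induced_add ` Q - {i}"
    have "finite ?J" "?J \<subseteq> induced_add ` Q" "induced_add u \<notin> ?J"
      using finite_induced_add[OF assms] u(2) by auto
    from separate_finite[OF u(1) this] show ?thesis
      using u(2) by (elim exE, intro exI) auto
  qed
  then show ?thesis by metis
qed

end

section \<open>Models of the theory\<close>

text \<open>The universal closure of the equation is a sentence true in \<open>V\<close>. Three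
  variables suffice for the laws to be transferred, associativity using all of them; the values
  \<open>undefined\<close> are never read, as no parameters or further variables occur.\<close>

lemma model_of_Th_universal_equation:
  fixes F :: "('v::group_add \<Rightarrow> 'v) set" and s t :: "('v \<Rightarrow> 'v, nat) trm"
  assumes "model_of_Th F M"
    and "tsyms s \<subseteq> F" "tsyms t \<subseteq> F" "tvars s \<subseteq> {0, 1, 2}" "tvars t \<subseteq> {0, 1, 2}"
    and "tpars s = {}" "tpars t = {}"
    and "\<And>a b c. teval nvs_struc (\<lambda>_. 0) ((\<lambda>_. 0)(0 := a, 1 := b, 2 := c)) s =
      teval nvs_struc (\<lambda>_. 0) ((\<lambda>_. 0)(0 := a, 1 := b, 2 := c)) t"
  shows "teval M (\<lambda>_. undefined) ((\<lambda>_. undefined)(0 := a, 1 := b, 2 := c)) s =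
    teval M (\<lambda>_. undefined) ((\<lambda>_. undefined)(0 := a, 1 := b, 2 := c)) t"
proof -
  let ?\<phi> = "Neg (Ex 0 (Ex 1 (Ex 2 (Neg (Eq s t)))))"
  have "in_lang F ?\<phi>" "fv ?\<phi> = {}" "fpars ?\<phi> = {}"
    using assms by (auto simp: in_lang_def)
  moreover have "sat nvs_struc (\<lambda>_. 0) (\<lambda>_. 0) ?\<phi>"
    using assms(8) by simp
  ultimately have "sat M (\<lambda>_. undefined) (\<lambda>_. undefined) ?\<phi>"
    using assms(1) unfolding model_of_Th_def by blast
  then show ?thesis by simp
qed

lemma lincomb_trm_tsyms_subset: "set X \<subseteq> F \<Longrightarrow> tsyms t \<subseteq> F \<Longrightarrow> tsyms (lincomb_trm X t) \<subseteq> F"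
  and lincomb_trm_tvars_subset: "tvars t \<subseteq> N \<Longrightarrow> tvars (lincomb_trm X t) \<subseteq> N"
  and lincomb_trm_tpars_empty: "tpars t = {} \<Longrightarrow> tpars (lincomb_trm X t) = {}"
  using lincomb_trm_tsyms[of X t] lincomb_trm_tvars[of X t] lincomb_trm_tpars[of X t] by auto

text \<open>The laws of the projections are verified in \<open>V\<close> on quasi-kernel vectors,
  extended by additivity, and then transferred to \<open>M\<close> as equations between
  terms.\<close>

lemma (in comm_nvs) model_split_struc:
  fixes M :: "('v \<Rightarrow> 'v, 'b) struc"
  assumes fin: "finite (blocks F)" and M: "model_of_Th F M"
  shows "\<exists>L. split_struc M F uminus zero_map id (induced_add ` Q) L"
proof -
  let ?I = "induced_add ` Q"
  have finI: "finite ?I" using finite_induced_add[OF fin] .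
  obtain L where L_F: "\<And>i. i \<in> ?I \<Longrightarrow> set (L i) \<subseteq> F"
    and L: "\<And>i x. i \<in> ?I \<Longrightarrow> x \<in> Q \<Longrightarrow> lc (L i) x = (if induced_add x = i then x else 0)"
    using exists_projections[OF fin] by metis
  obtain ls where ls: "set ls = ?I" "distinct ls"
    using finite_distinct_list[OF finI] by blast
  have L_add: "lc (L i) (x + y) = lc (L i) x + lc (L i) y" if "i \<in> ?I" for i x y
    using lc_add L_F[OF that] by blast
  have idem: "lc (L i) (lc (L i) x) = lc (L i) x" if i: "i \<in> ?I" for i x
  proof (rule additive_eqI[where f = "\<lambda>x. lc (L i) (lc (L i) x)" and g = "lc (L i)"])
    fix u assume u: "u \<in> Q"
    show "lc (L i) (lc (L i) u) = lc (L i) u"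
      using L[OF i u] lc_zero[OF L_F[OF i]] by presburger
  qed (simp_all add: L_add[OF i])
  have orth: "lc (L i) (lc (L j) x) = 0" if i: "i \<in> ?I" and j: "j \<in> ?I" and "i \<noteq> j" for i j x
  proof (rule additive_eqI[where f = "\<lambda>x. lc (L i) (lc (L j) x)" and g = "\<lambda>_. 0"])
    fix u assume u: "u \<in> Q"
    show "lc (L i) (lc (L j) u) = 0"
      using \<open>i \<noteq> j\<close> L[OF i u] L[OF j u] lc_zero[OF L_F[OF i]] by presburger
  qed (simp_all add: L_add i j)
  have plus: "\<exists>k\<in>F. \<forall>x. lc (L i) (c x + d x) = lc (L i) (k x)"
    if i: "i \<in> ?I" and c: "c \<in> F" and d: "d \<in> F" for i c d
  proof -
    obtain u where u: "u \<in> Q" "i = induced_add u" using i by blast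
    \<comment> \<open>The scalar \<open>k\<close> is the sum of \<open>c\<close> and
      \<open>d\<close> for the addition \<open>i\<close>; on vectors with another addition both
      sides vanish.\<close>
    obtain k where k: "k \<in> F" "(c, d, k) \<in> i"
      using induced_add_total[OF u(1) c d] u(2) by blast
    have "lc (L i) (c x + d x) = lc (L i) (k x)" for x
    proof (rule additive_eqI[where f = "\<lambda>x. lc (L i) (c x + d x)" and g = "\<lambda>x. lc (L i) (k x)"])
      fix x assume x: "x \<in> Q"
      show "lc (L i) (c x + d x) = lc (L i) (k x)"
      proof (cases "induced_add x = i")
        case True
        then have "c x + d x = k x" using k by (auto simp: induced_add_def)
        then show ?thesis by simp
      next
        case False
        then have "lc (L i) x = 0" using L[OF i x] by simp
        then show ?thesis
          by (simp add: L_add[OF i] lc_scal[OF L_F[OF i]] c d k(1) scal_zero)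
      qed
    qed (simp_all add: L_add[OF i] scal_add c d k(1) plus_ac)
    with k(1) show ?thesis by blast
  qed
  have concat_F: "set (concat (map L ls)) \<subseteq> F" using L_F ls by auto
  have sum: "lc (concat (map L ls)) x = x" for x
  proof (rule additive_eqI[where f = "lc (concat (map L ls))" and g = "\<lambda>x. x"])
    fix x assume x: "x \<in> Q"
    \<comment> \<open>Concatenating lists adds the projections; as \<open>js\<close> has no
      repetitions, a vector of \<open>Q\<close> is counted at most once.\<close>
    have "lc (concat (map L js)) x = (if induced_add x \<in> set js then x else 0)"
      if "set js \<subseteq> ?I" "distinct js" for js
      using that
      by (induction js) (auto simp: lc_append L[OF _ x])
    from this[of ls] show "lc (concat (map L ls)) x = x" using ls x by simp
  qed (simp_all add: lc_add[OF concat_F])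

  note univ = model_of_Th_universal_equation[OF M]
  note in_lang = lincomb_trm_tvars_subset lincomb_trm_tpars_empty
  let ?x = "Var 0" and ?y = "Var 1" and ?w = "Var 2"
  have assoc: "s_plus M (s_plus M x y) w = s_plus M x (s_plus M y w)" for x y w
    using univ[of "Plus (Plus ?x ?y) ?w" "Plus ?x (Plus ?y ?w)" x y w] by (simp add: add.assoc)
  have zero: "s_plus M (s_zero M) x = x" for x
    using univ[of "Plus Zero ?x" ?x x] by simp
  have append: "lincomb M (X @ Y) x = s_plus M (lincomb M X x) (lincomb M Y x)" for X Y x
    by (induction X) (auto simp: assoc zero)
  have "split_struc M F uminus zero_map id ?I L"
  proof
    show "s_plus M (s_plus M x y) w = s_plus M x (s_plus M y w)" for x y w by (rule assoc)
    show "s_plus M x y = s_plus M y x" for x y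
      using univ[of "Plus ?x ?y" "Plus ?y ?x" x y] by (simp add: add_comm)
    show "s_plus M (s_zero M) x = x" for x by (rule zero)
    show "s_plus M (s_fun M uminus x) x = s_zero M" for x
      using univ[of "Plus (Fun uminus ?x) ?x" Zero x] uminus_in by simp
    show "uminus \<in> F" "zero_map \<in> F" "id \<in> F" by (fact uminus_in zero_in id_in)+
    show "s_fun M zero_map x = s_zero M" for x
      using univ[of "Fun zero_map ?x" Zero x] zero_in by (simp add: zero_map_def)
    show "s_fun M id x = x" for x
      using univ[of "Fun id ?x" ?x x] id_in by simp
    show "s_fun M c (s_plus M x y) = s_plus M (s_fun M c x) (s_fun M c y)" if "c \<in> F" for c x y
      using univ[of "Fun c (Plus ?x ?y)" "Plus (Fun c ?x) (Fun c ?y)" x y] that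
      by (simp add: scal_add)
    show "\<exists>k\<in>F. \<forall>x. s_fun M c (s_fun M d x) = s_fun M k x" if "c \<in> F" "d \<in> F" for c d
    proof (intro bexI allI)
      show "c \<circ> d \<in> F" using scal_comp that by blast
      then show "s_fun M c (s_fun M d x) = s_fun M (c \<circ> d) x" for x
        using univ[of "Fun c (Fun d ?x)" "Fun (c \<circ> d) ?x" x] that by simp
    qed
    show "s_fun M c (s_fun M d x) = s_fun M d (s_fun M c x)" if "c \<in> F" "d \<in> F" for c d x
      using univ[of "Fun c (Fun d ?x)" "Fun d (Fun c ?x)" x] that scal_comm[OF that] by simp
    show "\<exists>d\<in>F. \<forall>x. s_fun M d (s_fun M c x) = x" if "c \<in> F" "c \<noteq> zero_map" for c
    proof (intro bexI allI)
      show "inv c \<in> F" using scal_inv[OF that] by blast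
      then show "s_fun M (inv c) (s_fun M c x) = x" for x
        using univ[of "Fun (inv c) (Fun c ?x)" ?x x] that scal_inv_eq[OF that] by simp
    qed
    show "finite ?I" by (rule finI)
    show "set (L i) \<subseteq> F" if "i \<in> ?I" for i using L_F[OF that] .
    show "\<exists>k\<in>F. \<forall>x. lincomb M (L i) (s_plus M (s_fun M c x) (s_fun M d x)) =
        lincomb M (L i) (s_fun M k x)" if i: "i \<in> ?I" and c: "c \<in> F" and d: "d \<in> F" for i c d
    proof -
      obtain k where k: "k \<in> F" "\<And>x. lc (L i) (c x + d x) = lc (L i) (k x)"
        using plus[OF i c d] by blast
      have "lincomb M (L i) (s_plus M (s_fun M c x) (s_fun M d x)) = lincomb M (L i) (s_fun M k x)" for x
        using univ[of "lincomb_trm (L i) (Plus (Fun c ?x) (Fun d ?x))" "lincomb_trm (L i) (Fun k ?x)" x]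
          c d k by (simp add: in_lang lincomb_trm_tsyms_subset[OF L_F[OF i]])
      with k(1) show ?thesis by blast
    qed
    show "lincomb M (L i) (lincomb M (L i) x) = lincomb M (L i) x" if i: "i \<in> ?I" for i x
      using univ[of "lincomb_trm (L i) (lincomb_trm (L i) ?x)" "lincomb_trm (L i) ?x" x] idem[OF i]
      by (simp add: in_lang lincomb_trm_tsyms_subset[OF L_F[OF i]])
    show "lincomb M (L i) (lincomb M (L j) x) = s_zero M"
      if i: "i \<in> ?I" and j: "j \<in> ?I" and ne: "i \<noteq> j" for i j x
      using univ[of "lincomb_trm (L i) (lincomb_trm (L j) ?x)" Zero x] orth[OF i j ne]
      by (simp add: in_lang lincomb_trm_tsyms_subset[OF L_F[OF i]]
        lincomb_trm_tsyms_subset[OF L_F[OF j]])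
    \<comment> \<open>This law is an implication; it follows in \<open>M\<close> from the
      transferred equation that the projections add up to the identity.\<close>
    show "x = s_zero M" if x: "\<And>i. i \<in> ?I \<Longrightarrow> lincomb M (L i) x = s_zero M" for x
    proof -
      have "lincomb M (concat (map L js)) x = s_zero M" if "set js \<subseteq> ?I" for js
        using that by (induction js) (simp_all add: append x zero)
      then have "lincomb M (concat (map L ls)) x = s_zero M" using ls(1) by blast
      moreover have "lincomb M (concat (map L ls)) x = x"
        using univ[of "lincomb_trm (concat (map L ls)) ?x" ?x x] sum
        by (simp add: in_lang lincomb_trm_tsyms_subset[OF concat_F])
      ultimately show ?thesis by simp
    qed
  qed
  then show ?thesis by blast
qed

text \<open>The set \<open>K\<close> represents the cardinal. The language consists of
  \<open>F\<close> and two further symbols, so for infinite \<open>K\<close> the bound on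
  \<open>F\<close> says that the cardinal is at least the size of the language.\<close>

theorem mainTheorem17:
  fixes F :: "('v::group_add \<Rightarrow> 'v) set"
    and M :: "('v \<Rightarrow> 'v, 'b) struc"
    and K :: "'c set"
  assumes "near_vector_space F"
    and "commutative_nvs F"
    and "finite (blocks F)"
    and "infinite K" and "F \<lesssim> K"
    and "model_of_Th F M"
  shows "stable_in F M K"
proof -
  interpret comm_nvs F using assms(1,2) by unfold_locales
  obtain L where "split_struc M F uminus zero_map id (induced_add ` Q) L"
    using model_split_struc[OF assms(3,6)] by blast
  then show ?thesis using assms(4,5) by (rule split_struc_stable_in)
qed

end
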